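(* Let $C\in\mathcal M\setminus\{0\}$. For every invertible $\Delta\in\mathcal M^{\geq}$ with eigenvalues $\lambda_1\geq\ldots\geq\lambda_n$, $$m(\Delta;\mathcal S_C)=\left(\sum_{j=1}^n\sigma_j(C)^2\,\lambda_{n-j+1}^{-1}\right)^{-1}.$$
   Context: $n$ is a positive integer, $\mathcal M$ is the algebra of complex $n\times n$ matrices, $\mathcal U$ the set of unitary matrices in $\mathcal M$, $\mathcal M^{\geq}$ the cone of non-negative Hermitian matrices in $\mathcal M$. Singular values are ordered decreasingly: $\sigma_1(C)\geq\ldots\geq\sigma_n(C)$. The $C$-numerical radius of $A\in\mathcal M$ is $w_C(A)=\max\{|\mathrm{tr}(UCU^*A)|:U\in\mathcal U\}$, and $\mathcal S_C=\{A\in\mathcal M:w_C(A)=1\}$. For a non-empty $\mathcal A\subseteq\mathcal M$, $m(\Delta;\mathcal A)$ denotes $\inf\{\mathrm{tr}(A\Delta A^* ):A\in\mathcal A\}$ when this infimum is attained; an assertion $m(\Delta;\mathcal A)=c$ means that the infimum is attained and equals $c$. *)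

theory Defs
  imports "HOL-Analysis.Analysis" "Jordan_Normal_Form.Schur_Decomposition"
begin

definition mat_trace :: "complex mat \<Rightarrow> complex" where
  "mat_trace A = (\<Sum>i<dim_row A. A $$ (i, i))"

definition unitary_mats :: "nat \<Rightarrow> complex mat set" where
  "unitary_mats n = {U \<in> carrier_mat n n.
     mat_adjoint U * U = 1\<^sub>m n \<and> U * mat_adjoint U = 1\<^sub>m n}"

definition nonneg_mats :: "nat \<Rightarrow> complex mat set" where
  "nonneg_mats n = {A \<in> carrier_mat n n.
     mat_adjoint A = A \<and> (\<forall>v \<in> carrier_vec n. 0 \<le> Re ((A *\<^sub>v v) \<bullet>c v))}"

(* For matrices whose eigenvalues are all real (e.g. Hermitian ones): the eigenvalues,
   repeated according to algebraic multiplicity, in decreasing order. *)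
definition decreasing_eigvals :: "complex mat \<Rightarrow> real list" where
  "decreasing_eigvals A = rev (sorted_list_of_multiset (image_mset Re (proots (char_poly A))))"

lemma decreasing_eigvals:
  assumes "A \<in> carrier_mat n n"
  shows "length (decreasing_eigvals A) = n" and "sorted_wrt (\<ge>) (decreasing_eigvals A)"
proof -
  have "length (sorted_list_of_multiset X) = size X" for X :: "real multiset"
    by (metis mset_sorted_list_of_multiset size_mset)
  thus "length (decreasing_eigvals A) = n"
    using degree_monic_char_poly[OF assms]
    by (simp add: decreasing_eigvals_def size_proots_complex)
  show "sorted_wrt (\<ge>) (decreasing_eigvals A)"
    unfolding decreasing_eigvals_def sorted_wrt_rev
    by (rule sorted_sorted_list_of_multiset)
qed

(* lambda_j and sigma_j below are indexed from j = 1. *)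
definition eigval :: "complex mat \<Rightarrow> nat \<Rightarrow> real" where
  "eigval A j = decreasing_eigvals A ! (j - 1)"

definition singular_value :: "complex mat \<Rightarrow> nat \<Rightarrow> real" where
  "singular_value A j = sqrt (eigval (mat_adjoint A * A) j)"

definition num_radius :: "complex mat \<Rightarrow> complex mat \<Rightarrow> real" where
  "num_radius C A =
     (SUP U \<in> unitary_mats (dim_row A). cmod (mat_trace (U * C * mat_adjoint U * A)))"

lemma mat_adjoint_dims [simp]:
  "dim_row (mat_adjoint A) = dim_col A" "dim_col (mat_adjoint A) = dim_row A"
  by (auto simp: mat_adjoint_def)

lemma mat_adjoint_index:
  fixes A :: "complex mat"
  assumes "i < dim_col A" "j < dim_row A"
  shows "mat_adjoint A $$ (i, j) = cnj (A $$ (j, i))"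
  using assms by (simp add: mat_adjoint_def mat_of_rows_index)

(* The supremum in num_radius is a maximum. *)
lemma num_radius_attained:
  assumes C: "C \<in> carrier_mat n n" and A: "A \<in> carrier_mat n n"
  shows "\<exists>U \<in> unitary_mats n.
           num_radius C A = cmod (mat_trace (U * C * mat_adjoint U * A)) \<and>
           (\<forall>V \<in> unitary_mats n. cmod (mat_trace (V * C * mat_adjoint V * A)) \<le> num_radius C A)"
proof -
  define M :: "(nat \<times> nat \<Rightarrow> complex) \<Rightarrow> complex mat" where "M f = mat n n f" for f
  define B :: "(nat \<times> nat \<Rightarrow> complex) set" where "B = Pi\<^sub>E UNIV (\<lambda>_. cball 0 1)"
  define K where "K = {f. (\<forall>i j. i < n \<longrightarrow> j < n \<longrightarrow>
     (\<Sum>k<n. cnj (f (k, i)) * f (k, j)) = (if i = j then 1 else 0) \<and>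
     (\<Sum>k<n. f (i, k) * cnj (f (j, k))) = (if i = j then 1 else 0))}"
  define g where "g f = cmod (\<Sum>i<n. \<Sum>l<n. (\<Sum>k<n. (\<Sum>j<n. f (i, j) * C $$ (j, k)) * cnj (f (l, k))) * A $$ (l, i))" for f
  have unit_iff: "M f \<in> unitary_mats n \<longleftrightarrow> f \<in> K" for f
    by (auto simp: M_def K_def unitary_mats_def mat_eq_iff scalar_prod_def
        mat_adjoint_index atLeast0LessThan)
  have tr: "cmod (mat_trace (M f * C * mat_adjoint (M f) * A)) = g f" for f
    using A C by (simp add: M_def g_def mat_trace_def scalar_prod_def mat_adjoint_index atLeast0LessThan)
  have le1: "cmod (f (i, j)) \<le> 1" if f: "f \<in> K" and ij: "i < n" "j < n" for f i j
  proof -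
    have "(\<Sum>k<n. f (i, k) * cnj (f (i, k))) = 1"
      using f ij by (auto simp: K_def)
    hence "complex_of_real (\<Sum>k<n. (cmod (f (i, k)))\<^sup>2) = complex_of_real 1"
      by (simp only: of_real_sum complex_norm_square of_real_1)
    hence "(\<Sum>k<n. (cmod (f (i, k)))\<^sup>2) = 1"
      by (simp only: of_real_eq_iff)
    moreover have "(cmod (f (i, j)))\<^sup>2 \<le> (\<Sum>k<n. (cmod (f (i, k)))\<^sup>2)"
      using ij by (intro member_le_sum) auto
    ultimately show ?thesis
      by (simp add: power2_le_imp_le)
  qed
  have cont: "continuous_on UNIV (\<lambda>f :: nat \<times> nat \<Rightarrow> complex. f p)" for p
    by (rule continuous_on_product_coordinates)
  have "compact B"
    unfolding B_def
    using compactin_PiE[of "\<lambda>_ :: nat \<times> nat. euclidean :: complex topology" UNIV "\<lambda>_. cball 0 1"]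
    by (simp add: euclidean_product_topology compactin_euclidean_iff)
  moreover have "closed K"
    unfolding K_def
    by (intro closed_Collect_all closed_Collect_imp open_Collect_const closed_Collect_conj closed_Collect_eq continuous_intros cont)
  ultimately have comp: "compact (B \<inter> K)"
    by (rule compact_Int_closed)
  define r where "r f = (\<lambda>(i, j). if i < n \<and> j < n then f (i, j) else 0)" for f :: "nat \<times> nat \<Rightarrow> complex"
  have Mr: "M (r f) = M f" for f
    by (auto simp: M_def r_def intro!: eq_matI)
  have rB: "r f \<in> B \<inter> K" if "f \<in> K" for f
  proof
    show "r f \<in> B"
      using le1[OF that] by (auto simp: B_def r_def)
    show "r f \<in> K"
      using that unit_iff[of f] unit_iff[of "r f"] by (simp add: Mr)
  qed
  have ex: "\<exists>f \<in> B \<inter> K. M f = V" if "V \<in> unitary_mats n" for V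
  proof -
    have "M (\<lambda>p. V $$ p) = V"
      using that by (auto simp: M_def unitary_mats_def intro!: eq_matI)
    thus ?thesis
      using that rB unit_iff Mr by metis
  qed
  have "1\<^sub>m n \<in> unitary_mats n"
    by (auto simp: unitary_mats_def mat_eq_iff scalar_prod_def mat_adjoint_index
        if_distrib sum.delta cong: if_cong)
  hence "B \<inter> K \<noteq> {}"
    using ex by blast
  moreover have "continuous_on (B \<inter> K) g"
    unfolding g_def
    by (intro continuous_intros continuous_on_subset[OF cont]) auto
  ultimately obtain f where f: "f \<in> B \<inter> K" "\<forall>h \<in> B \<inter> K. g h \<le> g f"
    using continuous_attains_sup[OF comp] by blast
  have U: "M f \<in> unitary_mats n"
    using f unit_iff by blast
  have max: "cmod (mat_trace (V * C * mat_adjoint V * A)) \<le> cmod (mat_trace (M f * C * mat_adjoint (M f) * A))"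
    if "V \<in> unitary_mats n" for V
    using ex[OF that] f(2) tr by metis
  have "num_radius C A = cmod (mat_trace (M f * C * mat_adjoint (M f) * A))"
    unfolding num_radius_def using A U max
    by (intro cSup_eq_maximum) auto
  thus ?thesis
    using U max by (intro bexI[of _ "M f"]) auto
qed

definition num_radius_sphere :: "nat \<Rightarrow> complex mat \<Rightarrow> complex mat set" where
  "num_radius_sphere n C = {A \<in> carrier_mat n n. num_radius C A = 1}"

(* The trace is real when Delta is Hermitian (lemma mat_trace_form_real); taking the real part
   only changes its type. *)
definition trace_form :: "complex mat \<Rightarrow> complex mat \<Rightarrow> real" where
  "trace_form \<Delta> A = Re (mat_trace (A * \<Delta> * mat_adjoint A))"

lemma mat_trace_form_real:
  assumes D: "\<Delta> \<in> nonneg_mats n" and A: "A \<in> carrier_mat n n"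
  shows "mat_trace (A * \<Delta> * mat_adjoint A) = complex_of_real (trace_form \<Delta> A)"
proof -
  let ?t = "\<lambda>i k j. A $$ (i, j) * \<Delta> $$ (j, k) * cnj (A $$ (i, k))"
  have Dc: "\<Delta> \<in> carrier_mat n n" and h: "mat_adjoint \<Delta> = \<Delta>"
    using D by (auto simp: nonneg_mats_def)
  have herm: "cnj (\<Delta> $$ (j, k)) = \<Delta> $$ (k, j)" if "j < n" "k < n" for j k
    using mat_adjoint_index[of k \<Delta> j] h Dc that by auto
  have t: "mat_trace (A * \<Delta> * mat_adjoint A) = (\<Sum>i<n. \<Sum>k<n. \<Sum>j<n. ?t i k j)"
    using A Dc by (simp add: mat_trace_def scalar_prod_def mat_adjoint_index atLeast0LessThan
        sum_distrib_right)
  have "cnj (\<Sum>i<n. \<Sum>k<n. \<Sum>j<n. ?t i k j) = (\<Sum>i<n. \<Sum>k<n. \<Sum>j<n. ?t i j k)"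
    by (auto simp: herm mult_ac intro!: sum.cong)
  also have "\<dots> = (\<Sum>i<n. \<Sum>k<n. \<Sum>j<n. ?t i k j)"
    by (intro sum.cong refl sum.swap)
  finally show ?thesis
    unfolding trace_form_def t Reals_cnj_iff[symmetric] by (rule of_real_Re[symmetric])
qed

definition min_trace :: "complex mat \<Rightarrow> complex mat set \<Rightarrow> real" where
  "min_trace \<Delta> \<A> = (INF A \<in> \<A>. trace_form \<Delta> A)"

(* "m(Delta; A) = c" reads: min_trace_attained holds and min_trace equals c. *)
definition min_trace_attained :: "complex mat \<Rightarrow> complex mat set \<Rightarrow> bool" where
  "min_trace_attained \<Delta> \<A> \<longleftrightarrow> (\<exists>A \<in> \<A>. \<forall>B \<in> \<A>. trace_form \<Delta> A \<le> trace_form \<Delta> B)"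

end

theory Submission
  imports Defs
begin

text \<open>
Write \<open>|X|\<close> for the Frobenius norm. Factor \<open>\<Delta> = M M\<^sup>*\<close> and let \<open>N\<^sup>*\<close> be the inverse of \<open>M\<close>,
so that \<open>\<Delta>\<close> has inverse \<open>N N\<^sup>*\<close>. Then \<open>tr (A \<Delta> A\<^sup>*) = |A M|\<^sup>2\<close>, while for \<open>Z = U C U\<^sup>*\<close>
\<open>tr (Z A) = tr (A Z) = tr ((A M) (N\<^sup>* Z))\<close>. By Cauchy-Schwarz
\<open>|tr (Z A)|\<^sup>2 \<le> tr (A \<Delta> A\<^sup>*) |N\<^sup>* Z|\<^sup>2\<close>, and \<open>|N\<^sup>* Z| = |N\<^sup>* U C|\<close>. If \<open>S\<close> is the maximum of
\<open>|N\<^sup>* U C|\<^sup>2\<close> over all unitary \<open>U\<close>, every \<open>A\<close> of numerical radius 1 therefore has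
\<open>tr (A \<Delta> A\<^sup>*) \<ge> 1 / S\<close>. If \<open>U\<^sub>0\<close> attains it and \<open>X = N\<^sup>* U\<^sub>0 C U\<^sub>0\<^sup>*\<close>, the equality case
\<open>A M = X\<^sup>* / S\<close> of Cauchy-Schwarz produces a minimiser. This is the lemma
\<open>trace_form_min_on_sphere\<close>.

It remains to show that \<open>S\<close> is the sum in the theorem. Diagonalise \<open>\<Delta>\<close> with eigenvalues \<open>\<mu>\<^sub>j\<close> in
increasing order by \<open>V\<close>, and \<open>C C\<^sup>*\<close> with eigenvalues \<open>s\<^sub>k\<close> in decreasing order by \<open>W\<close>
(\<open>hermitian_diagonalization_real\<close>). The \<open>s\<^sub>k\<close> are the squared singular values of \<open>C\<close>, because
\<open>C C\<^sup>*\<close> and \<open>C\<^sup>* C\<close> have the same characteristic polynomial (\<open>char_poly_mult_commute\<close>). With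
\<open>Q = V\<^sup>* U W\<close>, \<open>frobenius_sq_unitary_orbit\<close> gives
\<open>|N\<^sup>* U C|\<^sup>2 = \<Sum>\<^sub>j \<Sum>\<^sub>k \<mu>\<^sub>j\<^sup>-\<^sup>1 s\<^sub>k |Q\<^sub>j\<^sub>k|\<^sup>2\<close>. The matrix \<open>|Q\<^sub>j\<^sub>k|\<^sup>2\<close> is doubly stochastic, and
\<open>\<mu>\<^sub>j\<^sup>-\<^sup>1\<close> and \<open>s\<^sub>k\<close> are decreasing, so \<open>doubly_stochastic_sum_le\<close> bounds this by \<open>\<Sum>\<^sub>j \<mu>\<^sub>j\<^sup>-\<^sup>1 s\<^sub>j\<close>, with equality for
\<open>Q = 1\<close>, that is, \<open>U = V W\<^sup>*\<close>.
\<close>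

section \<open>Adjoints, traces and the Frobenius norm\<close>

declare mat_adjoint_index [simp]

lemma mat_adjoint_carrier [simp]:
  "A \<in> carrier_mat n m \<Longrightarrow> mat_adjoint A \<in> carrier_mat m n"
  by (auto intro!: carrier_matI)

text \<open>The carriers of the factors of a product are not determined by that of the product. A square left factor
fixes the inner dimension, which lets the simplifier discharge the side conditions of associativity.\<close>
lemma mult_square_carrier [simp]:
  "A \<in> carrier_mat n n \<Longrightarrow> B \<in> carrier_mat n m \<Longrightarrow> A * B \<in> carrier_mat n m"
  by simp

lemma mat_adjoint_adjoint [simp]:
  fixes A :: "complex mat"
  shows "mat_adjoint (mat_adjoint A) = A"
  by (rule eq_matI) auto

lemma mat_adjoint_mult:
  fixes A B :: "complex mat"
  assumes "A \<in> carrier_mat n m" "B \<in> carrier_mat m k"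
  shows "mat_adjoint (A * B) = mat_adjoint B * mat_adjoint A"
  by (rule eq_matI) (use assms in \<open>auto simp: scalar_prod_def mult.commute\<close>)

lemma mat_adjoint_one [simp]: "mat_adjoint (1\<^sub>m n :: complex mat) = 1\<^sub>m n"
  by (rule eq_matI) auto

lemma mat_diag_cong: "(\<And>i. i < n \<Longrightarrow> f i = g i) \<Longrightarrow> mat_diag n f = mat_diag n g"
  by (rule eq_matI) (auto simp: mat_diag_def)

lemma mat_adjoint_mat_diag:
  fixes f :: "nat \<Rightarrow> complex"
  shows "mat_adjoint (mat_diag n f) = mat_diag n (\<lambda>i. cnj (f i))"
  by (rule eq_matI) (auto simp: mat_diag_def)

lemma gram_mult_sqrt_diag:
  assumes V: "V \<in> carrier_mat n n" and f: "\<And>i. i < n \<Longrightarrow> 0 \<le> f i"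
  shows "(V * mat_diag n (\<lambda>i. complex_of_real (sqrt (f i)))) *
      mat_adjoint (V * mat_diag n (\<lambda>i. complex_of_real (sqrt (f i)))) =
    V * mat_diag n (\<lambda>i. complex_of_real (f i)) * mat_adjoint V"
    (is "(V * ?T) * mat_adjoint (V * ?T) = _")
proof -
  have "(V * ?T) * mat_adjoint (V * ?T) = V * (?T * ?T) * mat_adjoint V"
    using V by (simp add: mat_adjoint_mult[of _ n n _ n] mat_adjoint_mat_diag assoc_mult_mat[of _ n n _ n _ n]
        del: mat_diag_diag)
  also have "?T * ?T = mat_diag n (\<lambda>i. complex_of_real (f i))"
    using f by (auto intro!: mat_diag_cong simp flip: of_real_mult)
  finally show ?thesis .
qed

lemma unitary_matsD:
  assumes "U \<in> unitary_mats n"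
  shows "U \<in> carrier_mat n n" "mat_adjoint U * U = 1\<^sub>m n" "U * mat_adjoint U = 1\<^sub>m n"
  using assms by (auto simp: unitary_mats_def)

lemma unitary_matsI:
  assumes "U \<in> carrier_mat n n" "mat_adjoint U * U = 1\<^sub>m n"
  shows "U \<in> unitary_mats n"
  using assms mat_mult_left_right_inverse[of "mat_adjoint U" n U] by (auto simp: unitary_mats_def)

lemma unitary_mats_adjoint: "U \<in> unitary_mats n \<Longrightarrow> mat_adjoint U \<in> unitary_mats n"
  by (auto simp: unitary_mats_def)

lemma unitary_cancel:
  assumes U: "U \<in> unitary_mats n" and X: "X \<in> carrier_mat n m"
  shows "mat_adjoint U * (U * X) = X" "U * (mat_adjoint U * X) = X"
proof -
  note u = unitary_matsD[OF U]
  show "mat_adjoint U * (U * X) = X" "U * (mat_adjoint U * X) = X"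
    using u X by (simp_all add: assoc_mult_mat[symmetric, of _ n n _ n _ m])
qed

lemma unitary_mats_mult:
  assumes U: "U \<in> unitary_mats n" and V: "V \<in> unitary_mats n"
  shows "U * V \<in> unitary_mats n"
proof (rule unitary_matsI)
  note u = unitary_matsD[OF U] and v = unitary_matsD[OF V]
  show "U * V \<in> carrier_mat n n"
    using u v by simp
  have "mat_adjoint (U * V) * (U * V) = mat_adjoint V * (mat_adjoint U * (U * V))"
    using u v by (simp add: mat_adjoint_mult[of _ n n _ n] assoc_mult_mat[of _ n n _ n _ n])
  thus "mat_adjoint (U * V) * (U * V) = 1\<^sub>m n"
    using unitary_cancel(1)[OF U v(1)] v by simp
qed

lemma mat_trace_mult:
  assumes "A \<in> carrier_mat n m" "B \<in> carrier_mat m n"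
  shows "mat_trace (A * B) = (\<Sum>i<n. \<Sum>j<m. A $$ (i, j) * B $$ (j, i))"
  using assms by (simp add: mat_trace_def scalar_prod_def atLeast0LessThan)

lemma mat_trace_mult_commute:
  assumes "A \<in> carrier_mat n m" "B \<in> carrier_mat m n"
  shows "mat_trace (A * B) = mat_trace (B * A)"
  unfolding mat_trace_mult[OF assms] mat_trace_mult[OF assms(2,1)]
  by (subst sum.swap) (simp add: mult.commute)

lemma mat_trace_smult: "mat_trace (c \<cdot>\<^sub>m A) = c * mat_trace A" if "A \<in> carrier_mat n n"
  using that by (simp add: mat_trace_def sum_distrib_left)

definition frobenius_sq :: "complex mat \<Rightarrow> real" where
  "frobenius_sq X = (\<Sum>i<dim_row X. \<Sum>j<dim_col X. (cmod (X $$ (i, j)))\<^sup>2)"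

lemma frobenius_sq_eq:
  "X \<in> carrier_mat n m \<Longrightarrow> frobenius_sq X = (\<Sum>i<n. \<Sum>j<m. (cmod (X $$ (i, j)))\<^sup>2)"
  by (auto simp: frobenius_sq_def)

lemma frobenius_sq_nonneg: "0 \<le> frobenius_sq X"
  by (simp add: frobenius_sq_def sum_nonneg)

lemma frobenius_sq_trace:
  assumes "X \<in> carrier_mat n m"
  shows "mat_trace (X * mat_adjoint X) = of_real (frobenius_sq X)"
proof -
  have "mat_trace (X * mat_adjoint X) = (\<Sum>i<n. \<Sum>j<m. X $$ (i, j) * cnj (X $$ (i, j)))"
    using assms by (subst mat_trace_mult[OF assms mat_adjoint_carrier[OF assms]]) auto
  thus ?thesis
    by (simp only: frobenius_sq_eq[OF assms] of_real_sum complex_norm_square)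
qed

lemma frobenius_sq_adjoint:
  "frobenius_sq (mat_adjoint X) = frobenius_sq X"
  unfolding frobenius_sq_def by (simp, subst sum.swap, simp)

lemma frobenius_sq_smult:
  "frobenius_sq (c \<cdot>\<^sub>m X) = (cmod c)\<^sup>2 * frobenius_sq X"
  by (simp add: frobenius_sq_def sum_distrib_left norm_mult power_mult_distrib)

text \<open>The squared norm of \<open>Z B\<close> is the trace of \<open>Z (B B\<^sup>*) Z\<^sup>*\<close>, so \<open>B\<close> enters only through \<open>B B\<^sup>*\<close>. Unitary
invariance is one instance; another replaces \<open>C\<close> by a square root of \<open>C C\<^sup>*\<close> read off from an
eigenbasis.\<close>
lemma frobenius_sq_mult_cong:
  assumes Z: "Z \<in> carrier_mat m n" and B: "B \<in> carrier_mat n n" and C: "C \<in> carrier_mat n n"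
    and eq: "B * mat_adjoint B = C * mat_adjoint C"
  shows "frobenius_sq (Z * B) = frobenius_sq (Z * C)"
proof -
  have form: "Z * X * mat_adjoint (Z * X) = Z * (X * mat_adjoint X) * mat_adjoint Z"
    if X: "X \<in> carrier_mat n n" for X
    using Z X by (simp add: mat_adjoint_mult[of _ m n _ n] assoc_mult_mat[of _ m n _ n _ m]
        assoc_mult_mat[of _ m n _ n _ n] assoc_mult_mat[of _ n n _ n _ m])
  have "complex_of_real (frobenius_sq (Z * B)) = of_real (frobenius_sq (Z * C))"
    using Z B C by (simp add: frobenius_sq_trace[of _ m n, symmetric] form eq)
  thus ?thesis
    by simp
qed

lemma frobenius_sq_mult_unitary:
  assumes X: "X \<in> carrier_mat m n" and U: "U \<in> unitary_mats n"
  shows "frobenius_sq (X * U) = frobenius_sq X"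
  using frobenius_sq_mult_cong[OF X unitary_matsD(1)[OF U] one_carrier_mat] unitary_matsD[OF U] X
  by simp

lemma trace_Cauchy_Schwarz:
  assumes X: "X \<in> carrier_mat n m" and Y: "Y \<in> carrier_mat m n"
  shows "(cmod (mat_trace (X * Y)))\<^sup>2 \<le> frobenius_sq X * frobenius_sq Y"
proof -
  let ?I = "{..<n} \<times> {..<m}"
  let ?x = "\<lambda>(i, j). cmod (X $$ (i, j))" and ?y = "\<lambda>(i, j). cmod (Y $$ (j, i))"
  have "cmod (mat_trace (X * Y)) = cmod (\<Sum>(i, j)\<in>?I. X $$ (i, j) * Y $$ (j, i))"
    by (simp add: mat_trace_mult[OF X Y] sum.cartesian_product)
  also have "\<dots> \<le> (\<Sum>p\<in>?I. ?x p * ?y p)"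
    by (rule order.trans[OF norm_sum]) (simp add: norm_mult case_prod_unfold)
  finally have "(cmod (mat_trace (X * Y)))\<^sup>2 \<le> (\<Sum>p\<in>?I. ?x p * ?y p)\<^sup>2"
    by (intro power_mono) auto
  also have "\<dots> \<le> (\<Sum>p\<in>?I. (?x p)\<^sup>2) * (\<Sum>p\<in>?I. (?y p)\<^sup>2)"
    by (rule Cauchy_Schwarz_ineq_sum)
  also have "(\<Sum>p\<in>?I. (?x p)\<^sup>2) = frobenius_sq X"
    by (simp add: frobenius_sq_eq[OF X] sum.cartesian_product case_prod_unfold)
  also have "(\<Sum>p\<in>?I. (?y p)\<^sup>2) = frobenius_sq Y"
    unfolding frobenius_sq_eq[OF Y]
    by (subst sum.swap) (simp add: sum.cartesian_product case_prod_unfold)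
  finally show ?thesis .
qed

lemma frobenius_sq_eq_0:
  assumes "X \<in> carrier_mat n m" "frobenius_sq X = 0"
  shows "X = 0\<^sub>m n m"
proof (rule eq_matI)
  fix i j assume "i < dim_row (0\<^sub>m n m)" "j < dim_col (0\<^sub>m n m)"
  thus "X $$ (i, j) = 0\<^sub>m n m $$ (i, j)"
    using assms by (simp add: frobenius_sq_eq sum_nonneg sum_nonneg_eq_0_iff)
qed (use assms in auto)

lemma frobenius_sq_diag_mult_diag:
  assumes Q: "Q \<in> carrier_mat n n"
  shows "frobenius_sq (mat_diag n g * (Q * mat_diag n t)) =
    (\<Sum>j<n. \<Sum>k<n. (cmod (g j))\<^sup>2 * (cmod (t k))\<^sup>2 * (cmod (Q $$ (j, k)))\<^sup>2)"
proof -
  have "frobenius_sq (mat_diag n g * (Q * mat_diag n t)) =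
      (\<Sum>j<n. \<Sum>k<n. (cmod ((mat_diag n g * (Q * mat_diag n t)) $$ (j, k)))\<^sup>2)"
    using Q by (intro frobenius_sq_eq) simp
  also have "\<dots> = (\<Sum>j<n. \<Sum>k<n. (cmod (g j))\<^sup>2 * (cmod (t k))\<^sup>2 * (cmod (Q $$ (j, k)))\<^sup>2)"
    using Q by (simp add: mat_diag_mult_left[of _ n n] mat_diag_mult_right[of _ n n]
        norm_mult power_mult_distrib mult_ac)
  finally show ?thesis .
qed

lemma unitary_row_norm:
  assumes U: "U \<in> unitary_mats n" and j: "j < n"
  shows "(\<Sum>k<n. (cmod (U $$ (j, k)))\<^sup>2) = 1"
proof -
  have "(U * mat_adjoint U) $$ (j, j) = 1"
    using unitary_matsD(3)[OF U] j by simp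
  hence "(\<Sum>k<n. U $$ (j, k) * cnj (U $$ (j, k))) = 1"
    using unitary_matsD(1)[OF U] j by (simp add: scalar_prod_def atLeast0LessThan)
  hence "complex_of_real (\<Sum>k<n. (cmod (U $$ (j, k)))\<^sup>2) = of_real 1"
    by (simp only: of_real_sum complex_norm_square of_real_1)
  thus ?thesis
    by (simp only: of_real_eq_iff)
qed

lemma unitary_col_norm:
  assumes U: "U \<in> unitary_mats n" and k: "k < n"
  shows "(\<Sum>j<n. (cmod (U $$ (j, k)))\<^sup>2) = 1"
  using unitary_row_norm[OF unitary_mats_adjoint[OF U] k] unitary_matsD(1)[OF U] k by simp

section \<open>Doubly stochastic averages\<close>

text \<open>Abel summation: moving the last weight \<open>a n\<close> up to \<open>a (n - 1)\<close> on the nonnegative partial sum of \<open>d\<close> only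
increases the value, which is the induction step.\<close>
lemma sum_mult_decreasing_ge:
  fixes a d :: "nat \<Rightarrow> real"
  assumes dec: "\<And>i j. i \<le> j \<Longrightarrow> j < n \<Longrightarrow> a j \<le> a i"
    and part: "\<And>p. p \<le> n \<Longrightarrow> 0 \<le> (\<Sum>j<p. d j)" and "0 < n"
  shows "a (n - 1) * (\<Sum>j<n. d j) \<le> (\<Sum>j<n. a j * d j)"
  using assms
proof (induction n)
  case (Suc n)
  show ?case
  proof (cases "n = 0")
    case False
    have "a n * (\<Sum>j<n. d j) \<le> a (n - 1) * (\<Sum>j<n. d j)"
      using Suc.prems(1)[of "n - 1" n] Suc.prems(2)[of n] by (intro mult_right_mono) auto
    also have "\<dots> \<le> (\<Sum>j<n. a j * d j)"
      using False Suc.prems by (intro Suc.IH) auto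
    finally show ?thesis
      by (simp add: algebra_simps)
  qed simp
qed simp

text \<open>Weights in \<open>[0, 1]\<close> of total mass \<open>p\<close> do best on the \<open>p\<close> largest entries.\<close>
lemma weighted_sum_le_initial_sum:
  fixes b w :: "nat \<Rightarrow> real"
  assumes dec: "\<And>i j. i \<le> j \<Longrightarrow> j < n \<Longrightarrow> b j \<le> b i"
    and w: "\<And>k. k < n \<Longrightarrow> 0 \<le> w k \<and> w k \<le> 1"
    and tot: "(\<Sum>k<n. w k) = real p" and p: "p \<le> n"
  shows "(\<Sum>k<n. w k * b k) \<le> (\<Sum>k<p. b k)"
proof (cases "p = 0")
  case True
  hence "w k = 0" if "k < n" for k
    using tot w that sum_nonneg_eq_0_iff[of "{..<n}" w] by auto
  thus ?thesis
    using True by simp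
next
  case False
  define c where "c = b (p - 1)"
  define e :: "nat \<Rightarrow> real" where "e k = (if k < p then 1 else 0)" for k
  have sub: "{k \<in> {..<n}. k < p} = {..<p}"
    using p by auto
  have e: "(\<Sum>k<n. e k * f k) = (\<Sum>k<p. f k)" for f :: "nat \<Rightarrow> real"
    by (simp add: e_def if_distrib[of "\<lambda>x. x * _"] sum.If_cases Int_def sub[simplified] cong: if_cong)
  \<comment> \<open>Both factors are nonnegative for \<open>k < p\<close> and nonpositive for \<open>k \<ge> p\<close>; the shift by \<open>c\<close> is free
    because \<open>e\<close> and \<open>w\<close> have the same total mass.\<close>
  have "0 \<le> (\<Sum>k<n. (e k - w k) * (b k - c))"
  proof (rule sum_nonneg)
    fix k assume "k \<in> {..<n}"
    hence k: "k < n" by simp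
    show "0 \<le> (e k - w k) * (b k - c)"
    proof (cases "k < p")
      case True
      thus ?thesis
        using w[OF k] dec[of k "p - 1"] p by (auto simp: e_def c_def intro!: mult_nonneg_nonneg)
    next
      case False
      thus ?thesis
        using w[OF k] dec[of "p - 1" k] k by (auto simp: e_def c_def intro!: mult_nonneg_nonpos)
    qed
  qed
  also have "\<dots> = (\<Sum>k<n. e k * b k) - (\<Sum>k<n. w k * b k) - c * ((\<Sum>k<n. e k * 1) - (\<Sum>k<n. w k))"
    by (simp add: algebra_simps sum_subtractf sum.distrib sum_distrib_left)
  finally show ?thesis
    unfolding e tot by simp
qed

text \<open>The averages \<open>\<Sum>\<^sub>k D j k * b k\<close> are majorised by \<open>b\<close>: each partial sum over \<open>j < p\<close> weights \<open>b\<close> by partial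
column sums of \<open>D\<close>, which lie in \<open>[0, 1]\<close> and have total \<open>p\<close>. Abel summation against the decreasing sequence
\<open>a\<close> turns this into the inequality.\<close>
lemma doubly_stochastic_sum_le:
  fixes D :: "nat \<Rightarrow> nat \<Rightarrow> real"
  assumes a: "\<And>i j. i \<le> j \<Longrightarrow> j < n \<Longrightarrow> a j \<le> a i"
    and b: "\<And>i j. i \<le> j \<Longrightarrow> j < n \<Longrightarrow> b j \<le> b i"
    and D: "\<And>j k. j < n \<Longrightarrow> k < n \<Longrightarrow> 0 \<le> D j k"
    and row: "\<And>j. j < n \<Longrightarrow> (\<Sum>k<n. D j k) = 1"
    and col: "\<And>k. k < n \<Longrightarrow> (\<Sum>j<n. D j k) = 1"
  shows "(\<Sum>j<n. \<Sum>k<n. a j * b k * D j k) \<le> (\<Sum>j<n. a j * b j)"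
proof (cases "n = 0")
  case False
  define d where "d j = b j - (\<Sum>k<n. D j k * b k)" for j
  have swap: "(\<Sum>j<p. \<Sum>k<n. D j k * f k) = (\<Sum>k<n. (\<Sum>j<p. D j k) * f k)" for p f
    by (subst sum.swap) (simp add: sum_distrib_right)
  have part: "0 \<le> (\<Sum>j<p. d j)" if p: "p \<le> n" for p
  proof -
    have "(\<Sum>k<n. (\<Sum>j<p. D j k) * b k) \<le> (\<Sum>k<p. b k)"
    proof (rule weighted_sum_le_initial_sum)
      fix k assume k: "k < n"
      have "(\<Sum>j<p. D j k) \<le> (\<Sum>j<n. D j k)"
        using p k D by (intro sum_mono2) auto
      thus "0 \<le> (\<Sum>j<p. D j k) \<and> (\<Sum>j<p. D j k) \<le> 1"
        using col[OF k] p k D by (auto intro!: sum_nonneg)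
    next
      show "(\<Sum>k<n. \<Sum>j<p. D j k) = real p"
        using swap[of "\<lambda>_. 1" p] row p by simp
    qed (use b p in auto)
    thus ?thesis
      by (simp add: d_def sum_subtractf swap)
  qed
  have "(\<Sum>j<n. d j) = 0"
    using col by (simp add: d_def sum_subtractf swap)
  moreover have "a (n - 1) * (\<Sum>j<n. d j) \<le> (\<Sum>j<n. a j * d j)"
    using a part False by (intro sum_mult_decreasing_ge) auto
  ultimately show ?thesis
    by (simp add: d_def algebra_simps sum_subtractf sum_distrib_left)
qed simp


section \<open>Unitary diagonalisation of Hermitian matrices\<close>

text \<open>Complete \<open>v\<close> to a basis, orthogonalise by Gram-Schmidt, which keeps the first vector, and normalise the
columns. Orthonormal rather than orthogonal columns make conjugation by \<open>U\<close> preserve Hermitian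
matrices.\<close>
lemma unitary_mat_with_first_column:
  fixes v :: "complex vec"
  assumes v: "v \<in> carrier_vec n" "v \<noteq> 0\<^sub>v n" and n: "0 < n"
  shows "\<exists>U \<in> unitary_mats n. \<exists>c. col U 0 = c \<cdot>\<^sub>v v"
proof -
  interpret cof_vec_space n "TYPE(complex)" .
  define b where "b = basis_completion v"
  define ws where "ws = gram_schmidt n b"
  note bc = basis_completion[OF v, folded b_def]
  obtain vs where bv: "b = v # vs"
    using bc(6,7) n by (cases b) auto
  have ws: "set ws \<subseteq> carrier_vec n" "corthogonal ws" "length ws = n"
    using gram_schmidt_result[OF bc(2,4,5) refl, folded ws_def] bc(6) by auto
  have hd: "ws ! 0 = v"
    using gram_schmidt_hd[OF v(1), of vs, folded bv ws_def] ws(3) n by (metis hd_conv_nth length_greater_0_conv)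
  have wc: "ws ! j \<in> carrier_vec n" if "j < n" for j
    using ws that by auto
  define r where "r j = complex_of_real (sqrt (Re (ws ! j \<bullet>c ws ! j)))" for j
  have rr: "r j * r j = ws ! j \<bullet>c ws ! j" and r0: "r j \<noteq> 0" and rc: "cnj (r j) = r j" if j: "j < n" for j
  proof -
    have "0 \<le> ws ! j \<bullet>c ws ! j"
      by (rule conjugate_square_ge_0_vec)
    hence "0 \<le> Re (ws ! j \<bullet>c ws ! j)" and im: "of_real (Re (ws ! j \<bullet>c ws ! j)) = ws ! j \<bullet>c ws ! j"
      by (auto simp: less_eq_complex_def complex_eq_iff)
    thus rr: "r j * r j = ws ! j \<bullet>c ws ! j"
      by (simp add: r_def flip: of_real_mult)
    show "r j \<noteq> 0"
      using corthogonalD[OF ws(2), of j j] ws(3) j rr by auto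
    show "cnj (r j) = r j"
      by (simp add: r_def)
  qed
  define U where "U = mat n n (\<lambda>(i, j). ws ! j $ i / r j)"
  have U: "U \<in> carrier_mat n n"
    by (simp add: U_def)
  have "(mat_adjoint U * U) $$ (i, j) = 1\<^sub>m n $$ (i, j)" if i: "i < n" and j: "j < n" for i j
  proof -
    have "(mat_adjoint U * U) $$ (i, j) = (\<Sum>k<n. ws ! j $ k * cnj (ws ! i $ k)) / (r i * r j)"
      using i j by (simp add: U_def scalar_prod_def atLeast0LessThan sum_divide_distrib rc mult.commute)
    also have "(\<Sum>k<n. ws ! j $ k * cnj (ws ! i $ k)) = ws ! j \<bullet>c ws ! i"
      using wc[OF i] wc[OF j] by (simp add: scalar_prod_def atLeast0LessThan)
    also have "\<dots> / (r i * r j) = 1\<^sub>m n $$ (i, j)"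
      using corthogonalD[OF ws(2), of j i] ws(3) i j r0[OF i] by (auto simp: rr)
    finally show ?thesis .
  qed
  hence "mat_adjoint U * U = 1\<^sub>m n"
    using U by (intro eq_matI) auto
  hence "U \<in> unitary_mats n"
    using U by (rule unitary_matsI[rotated])
  moreover have "col U 0 = (1 / r 0) \<cdot>\<^sub>v v"
    using n v by (intro eq_vecI) (auto simp: U_def hd)
  ultimately show ?thesis
    by blast
qed

lemma mat_adjoint_four_block:
  fixes A :: "complex mat"
  assumes "A \<in> carrier_mat n n" "D \<in> carrier_mat m m"
  shows "mat_adjoint (four_block_mat A (0\<^sub>m n m) (0\<^sub>m m n) D) =
    four_block_mat (mat_adjoint A) (0\<^sub>m n m) (0\<^sub>m m n) (mat_adjoint D)"
  by (rule eq_matI) (use assms in auto)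

lemma mult_diag_four_block:
  fixes A :: "complex mat"
  assumes "A \<in> carrier_mat n n" "D \<in> carrier_mat m m" "A' \<in> carrier_mat n n" "D' \<in> carrier_mat m m"
  shows "four_block_mat A (0\<^sub>m n m) (0\<^sub>m m n) D * four_block_mat A' (0\<^sub>m n m) (0\<^sub>m m n) D' =
    four_block_mat (A * A') (0\<^sub>m n m) (0\<^sub>m m n) (D * D')"
  using assms by (subst mult_four_block_mat[of _ n n _ m _ m _ _ n _ m]) auto

text \<open>In an orthonormal basis that starts with an eigenvector, the first column is \<open>e\<close> times the first unit
vector; since the conjugated matrix is again Hermitian, the first row vanishes off the diagonal as well.\<close>
lemma hermitian_deflation:
  assumes A: "A \<in> carrier_mat (Suc m) (Suc m)" and herm: "mat_adjoint A = A" and e: "eigenvalue A e"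
  shows "\<exists>U \<in> unitary_mats (Suc m). \<exists>B \<in> carrier_mat m m. mat_adjoint B = B \<and>
    mat_adjoint U * A * U = four_block_mat (mat 1 1 (\<lambda>_. e)) (0\<^sub>m 1 m) (0\<^sub>m m 1) B"
proof -
  let ?n = "Suc m"
  obtain v where v: "v \<in> carrier_vec ?n" "v \<noteq> 0\<^sub>v ?n" "A *\<^sub>v v = e \<cdot>\<^sub>v v"
    using e A by (auto simp: eigenvalue_def eigenvector_def)
  obtain U c where U: "U \<in> unitary_mats ?n" and c: "col U 0 = c \<cdot>\<^sub>v v"
    using unitary_mat_with_first_column[OF v(1,2)] by auto
  note u = unitary_matsD[OF U]
  define A' where "A' = mat_adjoint U * A * U"
  have A': "A' \<in> carrier_mat ?n ?n"
    using u A by (simp add: A'_def)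
  have herm': "mat_adjoint A' = A'"
    using u A herm by (simp add: A'_def mat_adjoint_mult[of _ ?n ?n _ ?n] assoc_mult_mat[of _ ?n ?n _ ?n _ ?n])
  have "col A' 0 = (mat_adjoint U * A) *\<^sub>v col U 0"
    using u A by (auto simp: A'_def)
  also have "\<dots> = mat_adjoint U *\<^sub>v (A *\<^sub>v col U 0)"
    using u A v by (simp add: c assoc_mult_mat_vec[of _ ?n ?n _ ?n])
  also have "A *\<^sub>v col U 0 = e \<cdot>\<^sub>v col U 0"
    using A v by (simp add: c mult_mat_vec[of _ ?n ?n] smult_smult_assoc mult.commute)
  also have "mat_adjoint U *\<^sub>v (e \<cdot>\<^sub>v col U 0) = e \<cdot>\<^sub>v col (mat_adjoint U * U) 0"
    using u(1) mult_mat_vec[of "mat_adjoint U" ?n ?n "col U 0" e] col_carrier_vec[of 0 ?n U ?n]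
      col_mult2[of "mat_adjoint U" ?n ?n U ?n 0] by simp
  also have "\<dots> = e \<cdot>\<^sub>v unit_vec ?n 0"
    by (simp add: u)
  finally have c0: "col A' 0 = e \<cdot>\<^sub>v unit_vec ?n 0" .
  have col0: "A' $$ (i, 0) = (if i = 0 then e else 0)" if "i < ?n" for i
    using arg_cong[OF c0, of "\<lambda>x. x $ i"] that A' by (auto split: if_splits)
  have row0: "A' $$ (0, j) = 0" if "0 < j" "j < ?n" for j
    using arg_cong[OF herm', of "\<lambda>X. X $$ (0, j)"] that A' col0[of j] by simp
  define B where "B = mat m m (\<lambda>(i, j). A' $$ (Suc i, Suc j))"
  have "A' = four_block_mat (mat 1 1 (\<lambda>_. e)) (0\<^sub>m 1 m) (0\<^sub>m m 1) B"
    using A' col0 row0 by (intro eq_matI) (auto simp: B_def)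
  moreover have "mat_adjoint B = B"
  proof (rule eq_matI)
    fix i j assume "i < dim_row B" "j < dim_col B"
    thus "mat_adjoint B $$ (i, j) = B $$ (i, j)"
      using arg_cong[OF herm', of "\<lambda>X. X $$ (Suc i, Suc j)"] A' by (simp add: B_def)
  qed (auto simp: B_def)
  moreover have "B \<in> carrier_mat m m"
    by (simp add: B_def)
  ultimately show ?thesis
    using U unfolding A'_def by blast
qed

lemma unitary_similar_mat:
  assumes U: "U \<in> unitary_mats n" and A: "A \<in> carrier_mat n n"
  shows "similar_mat (mat_adjoint U * A * U) A"
  using unitary_matsD[OF U] A
  by (intro similar_matI[of _ _ "mat_adjoint U" U n]) auto

lemma unitary_conjugate_eq:
  assumes U: "U \<in> unitary_mats n" and A: "A \<in> carrier_mat n n"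
  shows "U * (mat_adjoint U * A * U) * mat_adjoint U = A"
proof -
  note u = unitary_matsD[OF U]
  have "U * (mat_adjoint U * A * U) * mat_adjoint U = U * (mat_adjoint U * (A * (U * mat_adjoint U)))"
    using u(1) A by (simp add: assoc_mult_mat[of _ n n _ n _ n])
  thus ?thesis
    using unitary_cancel(2)[OF U A] u A by simp
qed

text \<open>The diagonal follows the given list of roots, so the order of the eigenvalues can be prescribed.\<close>
lemma hermitian_diagonalization:
  assumes "A \<in> carrier_mat n n" "mat_adjoint A = A"
    and "char_poly A = (\<Prod>a\<leftarrow>es. [:- a, 1:])"
  shows "\<exists>U \<in> unitary_mats n. A = U * mat_diag n ((!) es) * mat_adjoint U"
  using assms
proof (induction es arbitrary: n A)
  case Nil
  hence "n = 0"
    using degree_monic_char_poly[OF Nil(1)] by simp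
  thus ?case
    using Nil by (intro bexI[of _ "1\<^sub>m n"]) (auto simp: unitary_mats_def)
next
  case (Cons e es)
  note A = Cons.prems(1) and cp = Cons.prems(3)
  have "poly (char_poly A) e = 0"
    by (simp add: cp)
  hence ev: "eigenvalue A e"
    using eigenvalue_root_char_poly[OF A] by simp
  have "n \<noteq> 0"
    using ev A by (auto simp: eigenvalue_def eigenvector_def)
  then obtain m where n: "n = Suc m"
    by (cases n) auto
  obtain U B where U: "U \<in> unitary_mats n" and B: "B \<in> carrier_mat m m" "mat_adjoint B = B"
    and blk: "mat_adjoint U * A * U = four_block_mat (mat 1 1 (\<lambda>_. e)) (0\<^sub>m 1 m) (0\<^sub>m m 1) B"
    using hermitian_deflation[of A m e] A Cons.prems(2) ev unfolding n by blast
  have "char_poly A = char_poly (mat 1 1 (\<lambda>_. e)) * char_poly B"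
    using char_poly_similar[OF unitary_similar_mat[OF U A]] B unfolding blk
    by (subst (asm) char_poly_four_block_zeros_col) auto
  also have "char_poly (mat 1 1 (\<lambda>_. e)) = [:- e, 1:]"
    by (simp add: char_poly_defs det_def sign_def)
  finally have "char_poly B = (\<Prod>a\<leftarrow>es. [:- a, 1:])"
    by (simp add: cp del: mult_pCons_left)
  from Cons.IH[OF B this] obtain P where P: "P \<in> unitary_mats m"
    and BP: "B = P * mat_diag m ((!) es) * mat_adjoint P"
    by blast
  note p = unitary_matsD[OF P] and u = unitary_matsD[OF U]
  define Q where "Q = four_block_mat (1\<^sub>m 1) (0\<^sub>m 1 m) (0\<^sub>m m 1) P"
  have Qc: "Q \<in> carrier_mat n n"
    using p by (auto simp: Q_def n)
  have Qa: "mat_adjoint Q = four_block_mat (1\<^sub>m 1) (0\<^sub>m 1 m) (0\<^sub>m m 1) (mat_adjoint P)"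
    using p by (simp add: Q_def mat_adjoint_four_block)
  have one: "four_block_mat (1\<^sub>m 1) (0\<^sub>m 1 m) (0\<^sub>m m 1) (1\<^sub>m m) = 1\<^sub>m n"
    by (auto simp: n)
  have Q: "Q \<in> unitary_mats n"
    using p Qc by (intro unitary_matsI) (simp_all add: Qa, simp add: Q_def mult_diag_four_block one[simplified])
  have diag: "mat_diag n ((!) (e # es)) =
      four_block_mat (mat 1 1 (\<lambda>_. e)) (0\<^sub>m 1 m) (0\<^sub>m m 1) (mat_diag m ((!) es))"
    by (rule eq_matI) (auto simp: n mat_diag_def)
  have "Q * mat_diag n ((!) (e # es)) * mat_adjoint Q = mat_adjoint U * A * U"
    unfolding diag Qa unfolding blk BP Q_def
    using p by (simp add: mult_diag_four_block)
  hence "A = U * (Q * mat_diag n ((!) (e # es)) * mat_adjoint Q) * mat_adjoint U"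
    using unitary_conjugate_eq[OF U A] by simp
  also have "\<dots> = (U * Q) * mat_diag n ((!) (e # es)) * mat_adjoint (U * Q)"
    using u(1) Qc by (simp add: mat_adjoint_mult[of _ n n _ n] assoc_mult_mat[of _ n n _ n _ n])
  finally show ?case
    using unitary_mats_mult[OF U Q] by blast
qed

lemma mset_complex_roots_char_poly:
  fixes A :: "complex mat"
  assumes A: "A \<in> carrier_mat n n" and as: "mset as = proots (char_poly A)"
  shows "char_poly A = (\<Prod>a\<leftarrow>as. [:- a, 1:])"
proof -
  have "char_poly A = Polynomial.smult (lead_coeff (char_poly A)) (\<Prod>a\<in>#mset as. [:- a, 1:])"
    unfolding as by (rule complex_poly_decompose_multiset[symmetric])
  moreover have "lead_coeff (char_poly A) = 1"
    using degree_monic_char_poly[OF A] by simp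
  ultimately show ?thesis
    by (simp add: prod_mset_prod_list[symmetric])
qed

text \<open>A first diagonalisation, with the roots in any order, has a Hermitian and hence real diagonal. Thus taking
real parts in \<open>decreasing_eigvals\<close> loses nothing, and the list \<open>es\<close>, mapped to the complex numbers, is a
legitimate list of roots for a second diagonalisation.\<close>
lemma hermitian_diagonalization_real:
  assumes A: "A \<in> carrier_mat n n" "mat_adjoint A = A"
    and es: "mset es = mset (decreasing_eigvals A)"
  shows "\<exists>U \<in> unitary_mats n. A = U * mat_diag n (\<lambda>i. complex_of_real (es ! i)) * mat_adjoint U"
proof -
  obtain as where as: "mset as = proots (char_poly A)"
    using ex_mset by blast
  have len: "length as = n"
    using degree_monic_char_poly[OF A(1)] arg_cong[OF as, of size] by (simp add: size_proots_complex)
  obtain U where U: "U \<in> unitary_mats n" and AU: "A = U * mat_diag n ((!) as) * mat_adjoint U"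
    using hermitian_diagonalization[OF A mset_complex_roots_char_poly[OF A(1) as]] by blast
  note u = unitary_matsD[OF U]
  let ?D = "mat_diag n ((!) as)"
  have D: "mat_adjoint U * A * U = ?D"
  proof -
    have "mat_adjoint U * A * U = mat_adjoint U * (U * (?D * (mat_adjoint U * U)))"
      unfolding AU using u(1) by (simp add: assoc_mult_mat[of _ n n _ n _ n])
    thus ?thesis
      using unitary_cancel(1)[OF U mat_diag_dim] u(2) by (simp add: right_mult_one_mat[OF mat_diag_dim])
  qed
  have "mat_adjoint ?D = ?D"
    unfolding D[symmetric] using u(1) A
    by (simp add: mat_adjoint_mult[of _ n n _ n] assoc_mult_mat[of _ n n _ n _ n])
  hence Dh: "mat_diag n (\<lambda>i. cnj (as ! i)) = ?D"
    unfolding mat_adjoint_mat_diag .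
  have "cnj (as ! i) = as ! i" if "i < n" for i
    using arg_cong[OF Dh, of "\<lambda>X. X $$ (i, i)"] that by (simp add: mat_diag_def)
  hence real: "complex_of_real (Re z) = z" if "z \<in> set as" for z
    using that len by (auto simp: in_set_conv_nth complex_eq_iff)
  have "mset es = image_mset Re (mset as)"
    using es by (simp add: decreasing_eigvals_def as)
  hence "mset (map complex_of_real es) = image_mset (\<lambda>z. complex_of_real (Re z)) (mset as)"
    by (simp add: multiset.map_comp o_def)
  also have "\<dots> = mset as"
    using real by (subst image_mset_cong[of _ _ "\<lambda>z. z"]) auto
  finally have "mset (map complex_of_real es) = proots (char_poly A)"
    unfolding as .
  from hermitian_diagonalization[OF A mset_complex_roots_char_poly[OF A(1) this]]
  obtain V where V: "V \<in> unitary_mats n"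
    and AV: "A = V * mat_diag n ((!) (map complex_of_real es)) * mat_adjoint V"
    by blast
  have "length es = n"
    using arg_cong[OF es, of size] decreasing_eigvals(1)[OF A(1)] by simp
  hence "mat_diag n ((!) (map complex_of_real es)) = mat_diag n (\<lambda>i. complex_of_real (es ! i))"
    by (intro eq_matI) (auto simp: mat_diag_def)
  thus ?thesis
    using V AV by auto
qed

lemma eigvals_nonneg:
  assumes A: "A \<in> nonneg_mats n" and x: "x \<in> set (decreasing_eigvals A)"
  shows "0 \<le> x"
proof -
  have Ac: "A \<in> carrier_mat n n"
    and nonneg: "\<And>v. v \<in> carrier_vec n \<Longrightarrow> 0 \<le> Re ((A *\<^sub>v v) \<bullet>c v)"
    using A by (auto simp: nonneg_mats_def)
  let ?p = "char_poly A"
  obtain z where z: "poly ?p z = 0" and xz: "x = Re z"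
  proof -
    have "?p \<noteq> 0"
      using degree_monic_char_poly[OF Ac] by auto
    thus ?thesis
      using that x by (auto simp: decreasing_eigvals_def)
  qed
  then obtain v where v: "v \<in> carrier_vec n" "v \<noteq> 0\<^sub>v n" "A *\<^sub>v v = z \<cdot>\<^sub>v v"
    using eigenvalue_root_char_poly[OF Ac] Ac by (auto simp: eigenvalue_def eigenvector_def)
  define r where "r = Re (v \<bullet>c v)"
  have "0 \<le> v \<bullet>c v" "v \<bullet>c v \<noteq> 0"
    using v by (auto intro: conjugate_square_ge_0_vec)
  hence r: "v \<bullet>c v = of_real r" "0 < r"
    by (auto simp: r_def less_eq_complex_def complex_eq_iff)
  have "(A *\<^sub>v v) \<bullet>c v = z * of_real r"
    using v by (simp add: r)
  hence "0 \<le> x * r"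
    using nonneg[OF v(1)] by (simp add: xz)
  thus ?thesis
    using r(2) by (simp add: zero_le_mult_iff)
qed

lemma mult_adjoint_nonneg:
  assumes C: "C \<in> carrier_mat n m"
  shows "mat_adjoint C * C \<in> nonneg_mats m"
proof -
  have "0 \<le> Re ((mat_adjoint C * C *\<^sub>v v) \<bullet>c v)" if v: "v \<in> carrier_vec m" for v
  proof -
    let ?w = "C *\<^sub>v v"
    have w: "?w \<in> carrier_vec n"
      using C v by simp
    have "(mat_adjoint C * C *\<^sub>v v) \<bullet>c v = (mat_adjoint C *\<^sub>v ?w) \<bullet>c v"
      using C v by (simp add: assoc_mult_mat_vec[of _ m n _ m])
    also have "\<dots> = (\<Sum>i<m. \<Sum>k<n. cnj (C $$ (k, i)) * ?w $ k * cnj (v $ i))"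
    proof -
      have "(mat_adjoint C *\<^sub>v ?w) $ i = (\<Sum>k<n. cnj (C $$ (k, i)) * ?w $ k)" if "i < m" for i
        using that C w by (simp add: scalar_prod_def[of _ ?w] atLeast0LessThan del: index_mult_mat_vec[of _ C])
      thus ?thesis
        using C v by (simp add: scalar_prod_def[of _ "conjugate v"] atLeast0LessThan sum_distrib_right)
    qed
    also have "\<dots> = (\<Sum>k<n. ?w $ k * cnj (\<Sum>i<m. C $$ (k, i) * v $ i))"
      by (subst sum.swap) (simp add: sum_distrib_left mult_ac)
    also have "\<dots> = ?w \<bullet>c ?w"
      using C v by (simp add: scalar_prod_def atLeast0LessThan)
    finally show ?thesis
      using conjugate_square_ge_0_vec[of ?w] by (simp add: less_eq_complex_def)
  qed
  thus ?thesis
    using C by (auto simp: nonneg_mats_def mat_adjoint_mult[of _ m n _ m])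
qed

lemma eigvals_pos:
  assumes A: "A \<in> nonneg_mats n" "invertible_mat A" and x: "x \<in> set (decreasing_eigvals A)"
  shows "0 < x"
proof -
  have Ac: "A \<in> carrier_mat n n" and herm: "mat_adjoint A = A"
    using A by (auto simp: nonneg_mats_def)
  let ?es = "decreasing_eigvals A"
  obtain U where U: "U \<in> unitary_mats n"
    and AU: "A = U * mat_diag n (\<lambda>i. complex_of_real (?es ! i)) * mat_adjoint U"
    using hermitian_diagonalization_real[OF Ac herm refl] by blast
  note u = unitary_matsD(1)[OF U]
  obtain B where AB: "A * B = 1\<^sub>m n" and BA: "B * A = 1\<^sub>m (dim_row B)"
    using A(2) Ac by (auto simp: invertible_mat_def inverts_mat_def)
  have "B \<in> carrier_mat n n"
    using arg_cong[OF AB, of dim_col] arg_cong[OF BA, of dim_col] Ac by auto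
  hence "det A * det B = 1"
    using Ac AB by (metis det_mult det_one)
  hence "det A \<noteq> 0"
    by auto
  moreover have "det A = det U * det (mat_diag n (\<lambda>i. complex_of_real (?es ! i))) * det (mat_adjoint U)"
    using arg_cong[OF AU, of det] u det_mult[of U n] det_mult[of "U * _" n] by simp
  ultimately have "det (mat_diag n (\<lambda>i. complex_of_real (?es ! i))) \<noteq> 0"
    by auto
  moreover have "det (mat_diag n (\<lambda>i. complex_of_real (?es ! i))) = (\<Prod>i<n. complex_of_real (?es ! i))"
    by (subst det_upper_triangular[of _ n]) (auto simp: mat_diag_def prod_list_diag_prod atLeast0LessThan)
  ultimately have "x \<noteq> 0"
    using x decreasing_eigvals(1)[OF Ac] by (auto simp: in_set_conv_nth)
  thus ?thesis
    using eigvals_nonneg[OF A(1) x] by simp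
qed

section \<open>Singular values\<close>

text \<open>The block matrices \<open>(AB, 0; B, 0)\<close> and \<open>(0, 0; B, BA)\<close> are similar through \<open>(1, A; 0, 1)\<close>. Their
characteristic polynomials are those of \<open>AB\<close> and \<open>BA\<close>, each multiplied by that of the zero matrix, which
can be cancelled.\<close>
lemma char_poly_mult_commute:
  fixes A B :: "complex mat"
  assumes A: "A \<in> carrier_mat n n" and B: "B \<in> carrier_mat n n"
  shows "char_poly (A * B) = char_poly (B * A)"
proof -
  let ?z = "0\<^sub>m n n :: complex mat" and ?o = "1\<^sub>m n :: complex mat"
  let ?X = "four_block_mat (A * B) ?z B ?z" and ?Y = "four_block_mat ?z ?z B (B * A)"
  let ?P = "four_block_mat ?o A ?z ?o" and ?Q = "four_block_mat ?o (- A) ?z ?o"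
  note mult = mult_four_block_mat[of _ n n _ n _ n _ _ n _ n]
  have AB: "A * B \<in> carrier_mat n n" and BA: "B * A \<in> carrier_mat n n"
    using A B by auto
  have z: "- ?z = ?z"
    by (rule eq_matI) auto
  have PQ: "?P * ?Q = 1\<^sub>m (n + n)"
    using A by (subst mult) (auto simp: z uminus_l_inv_mat[of _ n n])
  have QP: "?Q * ?P = 1\<^sub>m (n + n)"
    using A by (intro mat_mult_left_right_inverse[OF _ _ PQ]) auto
  have "?X * ?P = ?P * ?Y"
    using A B by (subst (1 2) mult) (auto simp: assoc_mult_mat[of _ n n _ n _ n])
  moreover have "?X * (?P * ?Q) = ?X * ?P * ?Q"
    using A B AB by (intro assoc_mult_mat[symmetric, of _ "n+n" "n+n" _ "n+n" _ "n+n"]) auto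
  ultimately have "?X = ?P * ?Y * ?Q"
    using A B AB unfolding PQ by (simp add: right_mult_one_mat[of _ "n+n" "n+n"])
  hence "similar_mat ?X ?Y"
    using A B PQ QP by (intro similar_matI[of _ _ ?P ?Q "n + n"]) auto
  hence "char_poly ?X = char_poly ?Y"
    by (rule char_poly_similar)
  moreover have fac: "\<exists>es. char_poly M = (\<Prod>a\<leftarrow>es. [:- a, 1:])" if "M \<in> carrier_mat n n" for M :: "complex mat"
    using char_poly_factorized[OF that] by blast
  have "char_poly ?X = char_poly (A * B) * char_poly ?z"
    using A B by (intro char_poly_0_block'[OF refl fac fac]) auto
  moreover have "char_poly ?Y = char_poly ?z * char_poly (B * A)"
    using A B by (intro char_poly_0_block'[OF refl fac fac]) auto
  moreover have "char_poly ?z \<noteq> 0"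
    using degree_monic_char_poly[of ?z n] by auto
  ultimately show ?thesis
    by simp
qed

text \<open>Singular values are defined through \<open>C\<^sup>* C\<close>, but the norm of \<open>N\<^sup>* U C\<close>, with its factors to the left of \<open>C\<close>,
depends on \<open>C C\<^sup>*\<close>.\<close>
lemma decreasing_eigvals_gram:
  assumes "C \<in> carrier_mat n n"
  shows "decreasing_eigvals (C * mat_adjoint C) = decreasing_eigvals (mat_adjoint C * C)"
  using char_poly_mult_commute[of C n "mat_adjoint C"] assms by (simp add: decreasing_eigvals_def)

section \<open>The minimum over the sphere\<close>

lemma trace_form_gram:
  assumes A: "A \<in> carrier_mat n n" and M: "M \<in> carrier_mat n n"
  shows "trace_form (M * mat_adjoint M) A = frobenius_sq (A * M)"
proof -
  have "A * (M * mat_adjoint M) * mat_adjoint A = A * M * mat_adjoint (A * M)"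
    using A M by (simp add: mat_adjoint_mult[of _ n n _ n] assoc_mult_mat[of _ n n _ n _ n])
  thus ?thesis
    using A M by (simp add: trace_form_def frobenius_sq_trace[of _ n n])
qed

text \<open>Duality between the trace form and the numerical radius: Cauchy-Schwarz in the form
\<open>|tr (U C U\<^sup>* A)|\<^sup>2 \<le> |A M|\<^sup>2 |N\<^sup>* U C|\<^sup>2\<close> bounds the form from below by the reciprocal of
\<open>S = max |N\<^sup>* U C|\<^sup>2\<close>, and its equality case at the maximising \<open>V\<close> supplies the minimiser.\<close>
lemma trace_form_min_on_sphere:
  assumes C: "C \<in> carrier_mat n n" and M: "M \<in> carrier_mat n n" and N: "N \<in> carrier_mat n n"
    and NM: "mat_adjoint N * M = 1\<^sub>m n" and S: "0 < S"
    and le: "\<And>U. U \<in> unitary_mats n \<Longrightarrow> frobenius_sq (mat_adjoint N * (U * C)) \<le> S"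
    and V: "V \<in> unitary_mats n" and eq: "frobenius_sq (mat_adjoint N * (V * C)) = S"
  shows "\<exists>A \<in> num_radius_sphere n C. trace_form (M * mat_adjoint M) A = 1 / S"
    and "\<And>A. A \<in> num_radius_sphere n C \<Longrightarrow> 1 / S \<le> trace_form (M * mat_adjoint M) A"
proof -
  define X where "X U = mat_adjoint N * (U * C * mat_adjoint U)" for U
  have X: "X U \<in> carrier_mat n n" if "U \<in> unitary_mats n" for U
    using unitary_matsD(1)[OF that] N C by (simp add: X_def)
  have MN: "M * mat_adjoint N = 1\<^sub>m n"
    using mat_mult_left_right_inverse[OF _ M NM] N by simp
  have fX: "frobenius_sq (X U) = frobenius_sq (mat_adjoint N * (U * C))" if U: "U \<in> unitary_mats n" for U
  proof -
    note u = unitary_matsD(1)[OF U]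
    have "X U = mat_adjoint N * (U * C) * mat_adjoint U"
      using u N C by (simp add: X_def assoc_mult_mat[of _ n n _ n _ n])
    thus ?thesis
      using frobenius_sq_mult_unitary[of "mat_adjoint N * (U * C)" n n "mat_adjoint U"]
        unitary_mats_adjoint[OF U] u N C by simp
  qed
  have tr: "mat_trace (U * C * mat_adjoint U * A) = mat_trace (A * M * X U)"
    if U: "U \<in> unitary_mats n" and A: "A \<in> carrier_mat n n" for U A
  proof -
    note u = unitary_matsD(1)[OF U]
    have "A * M * X U = A * (M * mat_adjoint N) * (U * C * mat_adjoint U)"
      using u A M N C by (simp add: X_def assoc_mult_mat[of _ n n _ n _ n])
    also have "\<dots> = A * (U * C * mat_adjoint U)"
      using A by (simp add: MN)
    finally show ?thesis
      using mat_trace_mult_commute[of A n n "U * C * mat_adjoint U"] u A C by simp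
  qed
  have bound: "(cmod (mat_trace (U * C * mat_adjoint U * A)))\<^sup>2 \<le> trace_form (M * mat_adjoint M) A * S"
    if U: "U \<in> unitary_mats n" and A: "A \<in> carrier_mat n n" for U A
  proof -
    have "(cmod (mat_trace (A * M * X U)))\<^sup>2 \<le> frobenius_sq (A * M) * frobenius_sq (X U)"
      using A M X[OF U] by (intro trace_Cauchy_Schwarz[of _ n n]) auto
    also have "\<dots> \<le> frobenius_sq (A * M) * S"
      using le[OF U] fX[OF U] by (intro mult_left_mono) (auto simp: frobenius_sq_nonneg)
    finally show ?thesis
      using A M by (simp add: tr[OF U A] trace_form_gram)
  qed
  show "1 / S \<le> trace_form (M * mat_adjoint M) A" if A: "A \<in> num_radius_sphere n C" for A
  proof -
    have Ac: "A \<in> carrier_mat n n" and w: "num_radius C A = 1"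
      using A by (auto simp: num_radius_sphere_def)
    obtain U where "U \<in> unitary_mats n" "cmod (mat_trace (U * C * mat_adjoint U * A)) = 1"
      using num_radius_attained[OF C Ac] w by auto
    with bound[of U A] Ac S show ?thesis
      by (simp add: divide_le_eq)
  qed
  \<comment> \<open>Chosen so that \<open>A M\<close> is proportional to the adjoint of \<open>X V\<close>; the factor \<open>1 / S\<close> makes the
    numerical radius equal to 1.\<close>
  define A where "A = complex_of_real (1 / S) \<cdot>\<^sub>m (mat_adjoint (X V) * mat_adjoint N)"
  have A: "A \<in> carrier_mat n n"
    using X[OF V] N by (simp add: A_def)
  have AM: "A * M = complex_of_real (1 / S) \<cdot>\<^sub>m mat_adjoint (X V)"
    using X[OF V] M N NM by (simp add: A_def mult_smult_assoc_mat[of _ n n _ n] assoc_mult_mat[of _ n n _ n _ n])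
  have form: "trace_form (M * mat_adjoint M) A = 1 / S"
    using S by (simp add: trace_form_gram[OF A M] AM frobenius_sq_smult frobenius_sq_adjoint
        fX[OF V] eq power2_eq_square norm_divide)
  \<comment> \<open>The same bound controls every other unitary, so the numerical radius is attained at \<open>V\<close>.\<close>
  have upper: "cmod (mat_trace (U * C * mat_adjoint U * A)) \<le> 1" if U: "U \<in> unitary_mats n" for U
    using bound[OF U A] S by (simp add: form power_le_one_iff)
  have "mat_trace (V * C * mat_adjoint V * A) = complex_of_real (1 / S) * mat_trace (mat_adjoint (X V) * X V)"
    unfolding tr[OF V A] AM using X[OF V]
    by (simp add: mult_smult_assoc_mat[of _ n n _ n] mat_trace_smult[of _ n])
  also have "mat_trace (mat_adjoint (X V) * X V) = of_real S"
    using frobenius_sq_trace[OF mat_adjoint_carrier[OF X[OF V]]] by (simp add: frobenius_sq_adjoint fX[OF V] eq)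
  finally have one: "cmod (mat_trace (V * C * mat_adjoint V * A)) = 1"
    using S by (simp add: norm_mult norm_divide)
  obtain U where "U \<in> unitary_mats n" "num_radius C A = cmod (mat_trace (U * C * mat_adjoint U * A))"
    and ge: "\<forall>V \<in> unitary_mats n. cmod (mat_trace (V * C * mat_adjoint V * A)) \<le> num_radius C A"
    using num_radius_attained[OF C A] by blast
  hence "num_radius C A = 1"
    using upper[of U] one V by (intro antisym) auto
  thus "\<exists>A \<in> num_radius_sphere n C. trace_form (M * mat_adjoint M) A = 1 / S"
    using A form by (auto simp: num_radius_sphere_def)
qed

text \<open>By \<open>frobenius_sq_mult_cong\<close>, \<open>C\<close> may be replaced by \<open>W T\<close> with \<open>T\<close> the diagonal matrix of the \<open>sqrt (s k)\<close>; what
remains is the unitary matrix \<open>V\<^sup>* U W\<close> between two diagonal ones.\<close>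
lemma frobenius_sq_unitary_orbit:
  fixes g s :: "nat \<Rightarrow> real"
  assumes C: "C \<in> carrier_mat n n" and V: "V \<in> unitary_mats n" and W: "W \<in> unitary_mats n"
    and CC: "C * mat_adjoint C = W * mat_diag n (\<lambda>k. complex_of_real (s k)) * mat_adjoint W"
    and s: "\<And>k. k < n \<Longrightarrow> 0 \<le> s k" and U: "U \<in> unitary_mats n"
  shows "frobenius_sq (mat_adjoint (V * mat_diag n (\<lambda>j. complex_of_real (g j))) * (U * C)) =
    (\<Sum>j<n. \<Sum>k<n. (g j)\<^sup>2 * s k * (cmod ((mat_adjoint V * U * W) $$ (j, k)))\<^sup>2)"
proof -
  note v = unitary_matsD(1)[OF V] and w = unitary_matsD(1)[OF W] and u = unitary_matsD(1)[OF U]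
  let ?G = "mat_diag n (\<lambda>j. complex_of_real (g j))"
  let ?T = "mat_diag n (\<lambda>k. complex_of_real (sqrt (s k)))"
  have adj: "mat_adjoint (V * ?G) = ?G * mat_adjoint V"
    using v by (simp add: mat_adjoint_mult[of _ n n _ n] mat_adjoint_mat_diag)
  have "C * mat_adjoint C = (W * ?T) * mat_adjoint (W * ?T)"
    unfolding CC by (rule gram_mult_sqrt_diag[OF w s, symmetric])
  hence "frobenius_sq (?G * mat_adjoint V * U * C) = frobenius_sq (?G * mat_adjoint V * U * (W * ?T))"
    using v u w C by (intro frobenius_sq_mult_cong[of _ n n]) auto
  also have "?G * mat_adjoint V * U * (W * ?T) = ?G * ((mat_adjoint V * U * W) * ?T)"
    using v u w by (simp add: assoc_mult_mat[of _ n n _ n _ n])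
  also have "frobenius_sq \<dots> = (\<Sum>j<n. \<Sum>k<n. (g j)\<^sup>2 * s k * (cmod ((mat_adjoint V * U * W) $$ (j, k)))\<^sup>2)"
    using v u w s by (subst frobenius_sq_diag_mult_diag) auto
  finally show ?thesis
    unfolding adj using v u C by (simp add: assoc_mult_mat[of _ n n _ n _ n])
qed

theorem proposition4p6:
  fixes n :: nat and C \<Delta> :: "complex mat"
  assumes "n > 0"
    and "C \<in> carrier_mat n n" and "C \<noteq> 0\<^sub>m n n"
    and "\<Delta> \<in> nonneg_mats n" and "invertible_mat \<Delta>"
  shows "min_trace_attained \<Delta> (num_radius_sphere n C) \<and>
    min_trace \<Delta> (num_radius_sphere n C) =
      inverse (\<Sum>j = 1..n. (singular_value C j)\<^sup>2 * inverse (eigval \<Delta> (n - j + 1)))"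
proof -
  note C = assms(2)
  have \<Delta>: "\<Delta> \<in> carrier_mat n n" "mat_adjoint \<Delta> = \<Delta>"
    using assms(4) by (auto simp: nonneg_mats_def)
  have CC: "C * mat_adjoint C \<in> carrier_mat n n" "mat_adjoint (C * mat_adjoint C) = C * mat_adjoint C"
    using C by (auto simp: mat_adjoint_mult[of _ n n _ n])
  have C'C: "mat_adjoint C * C \<in> carrier_mat n n"
    using C by simp
  define s where "s k = decreasing_eigvals (mat_adjoint C * C) ! k" for k
  \<comment> \<open>The reversed list is increasing, so that the eigenvalues \<open>inverse (\<mu> j)\<close> of the inverse of \<open>\<Delta>\<close>
    decrease along with \<open>s\<close>.\<close>
  define \<mu> where "\<mu> j = rev (decreasing_eigvals \<Delta>) ! j" for j
  note len = decreasing_eigvals(1)[OF C'C] decreasing_eigvals(1)[OF \<Delta>(1)]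
  have s_nonneg: "0 \<le> s k" if "k < n" for k
    using eigvals_nonneg[OF mult_adjoint_nonneg[OF C]] that len by (simp add: s_def)
  have \<mu>_pos: "0 < \<mu> j" if "j < n" for j
    using eigvals_pos[OF assms(4,5), of "\<mu> j"] that len nth_mem[of j "rev (decreasing_eigvals \<Delta>)"]
    by (simp add: \<mu>_def)
  have s_dec: "s k \<le> s i" if "i \<le> k" "k < n" for i k
    using sorted_wrt_nth_less[OF decreasing_eigvals(2)[OF C'C], of i k] that len
    by (cases "i = k") (auto simp: s_def)
  have \<mu>_inc: "\<mu> i \<le> \<mu> j" if "i \<le> j" "j < n" for i j
    using sorted_wrt_nth_less[OF decreasing_eigvals(2)[OF \<Delta>(1)], of "n - Suc j" "n - Suc i"] that len
    by (cases "i = j") (auto simp: \<mu>_def rev_nth)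
  define S where "S = (\<Sum>j<n. inverse (\<mu> j) * s j)"
  have sum_eq: "(\<Sum>j = 1..n. (singular_value C j)\<^sup>2 * inverse (eigval \<Delta> (n - j + 1))) = S"
  proof -
    have "(\<Sum>j = 1..n. (singular_value C j)\<^sup>2 * inverse (eigval \<Delta> (n - j + 1))) =
        (\<Sum>j<n. (singular_value C (Suc j))\<^sup>2 * inverse (eigval \<Delta> (n - Suc j + 1)))"
      by (simp add: sum.atLeast1_atMost_eq)
    also have "\<dots> = S"
      unfolding S_def
    proof (rule sum.cong)
      fix j assume "j \<in> {..<n}"
      thus "(singular_value C (Suc j))\<^sup>2 * inverse (eigval \<Delta> (n - Suc j + 1)) = inverse (\<mu> j) * s j"
        using s_nonneg[of j] len by (simp add: singular_value_def eigval_def s_def \<mu>_def rev_nth)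
    qed simp
    finally show ?thesis .
  qed
  obtain V where V: "V \<in> unitary_mats n"
    and \<Delta>V: "\<Delta> = V * mat_diag n (\<lambda>j. complex_of_real (\<mu> j)) * mat_adjoint V"
    using hermitian_diagonalization_real[OF \<Delta>, of "rev (decreasing_eigvals \<Delta>)"] by (auto simp: \<mu>_def)
  obtain W where W: "W \<in> unitary_mats n"
    and CW: "C * mat_adjoint C = W * mat_diag n (\<lambda>k. complex_of_real (s k)) * mat_adjoint W"
    using hermitian_diagonalization_real[OF CC refl] unfolding decreasing_eigvals_gram[OF C] s_def by blast
  note v = unitary_matsD[OF V] and w = unitary_matsD[OF W]
  define g where "g j = sqrt (inverse (\<mu> j))" for j
  have g2: "(g j)\<^sup>2 = inverse (\<mu> j)" if "j < n" for j
    using \<mu>_pos[OF that] by (simp add: g_def)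
  let ?R = "mat_diag n (\<lambda>j. complex_of_real (sqrt (\<mu> j)))"
  let ?G = "mat_diag n (\<lambda>j. complex_of_real (g j))"
  define M where "M = V * ?R"
  define N where "N = V * ?G"
  have M: "M \<in> carrier_mat n n" and N: "N \<in> carrier_mat n n"
    using v by (simp_all add: M_def N_def)
  have MM: "M * mat_adjoint M = \<Delta>"
    unfolding M_def \<Delta>V using \<mu>_pos by (intro gram_mult_sqrt_diag v) (simp add: less_imp_le)
  have "mat_adjoint N * M = ?G * (mat_adjoint V * (V * ?R))"
    using v(1) by (simp add: M_def N_def mat_adjoint_mult[of _ n n _ n] mat_adjoint_mat_diag assoc_mult_mat[of _ n n _ n _ n])
  also have "\<dots> = ?G * ?R"
    by (simp only: unitary_cancel(1)[OF V mat_diag_dim])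
  also have "\<dots> = 1\<^sub>m n"
  proof -
    have "complex_of_real (g j) * complex_of_real (sqrt (\<mu> j)) = 1" if "j < n" for j
      using \<mu>_pos[OF that] by (simp add: g_def real_sqrt_inverse flip: of_real_mult)
    hence "mat_diag n (\<lambda>j. complex_of_real (g j) * complex_of_real (sqrt (\<mu> j))) = mat_diag n (\<lambda>_. 1)"
      by (rule mat_diag_cong)
    thus ?thesis
      by simp
  qed
  finally have NM: "mat_adjoint N * M = 1\<^sub>m n" .
  have orbit: "frobenius_sq (mat_adjoint N * (U * C)) =
      (\<Sum>j<n. \<Sum>k<n. inverse (\<mu> j) * s k * (cmod ((mat_adjoint V * U * W) $$ (j, k)))\<^sup>2)"
    if U: "U \<in> unitary_mats n" for U
    unfolding N_def by (subst frobenius_sq_unitary_orbit[OF C V W CW s_nonneg U]) (simp_all add: g2)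
  have le: "frobenius_sq (mat_adjoint N * (U * C)) \<le> S" if U: "U \<in> unitary_mats n" for U
  proof -
    have "mat_adjoint V * U * W \<in> unitary_mats n"
      by (intro unitary_mats_mult unitary_mats_adjoint U V W)
    thus ?thesis
      unfolding orbit[OF U] S_def
      using s_dec \<mu>_inc \<mu>_pos unitary_row_norm unitary_col_norm
      by (intro doubly_stochastic_sum_le) (auto intro: le_imp_inverse_le)
  qed
  \<comment> \<open>This \<open>U\<close> aligns the eigenvectors of \<open>C C\<^sup>*\<close> with those of \<open>\<Delta>\<close>: the doubly stochastic matrix becomes the
    identity.\<close>
  define U where "U = V * mat_adjoint W"
  have U: "U \<in> unitary_mats n"
    unfolding U_def by (intro unitary_mats_mult unitary_mats_adjoint V W)
  have "mat_adjoint V * U * W = 1\<^sub>m n"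
    using v w unitary_cancel(1)[OF V, of "mat_adjoint W" n] by (simp add: U_def)
  hence eq: "frobenius_sq (mat_adjoint N * (U * C)) = S"
    unfolding orbit[OF U] S_def
    by (intro sum.cong refl) (simp add: if_distrib[of "\<lambda>x. x ^ 2"] if_distrib[of "\<lambda>x. _ * x"] if_distrib[of cmod] cong: if_cong)
  \<comment> \<open>\<open>N\<^sup>* U C\<close> vanishes only for \<open>C = 0\<close>, since \<open>N\<^sup>*\<close> and \<open>U\<close> are invertible.\<close>
  have "S \<noteq> 0"
  proof
    assume "S = 0"
    note u = unitary_matsD[OF U]
    have MN: "M * mat_adjoint N = 1\<^sub>m n"
      using mat_mult_left_right_inverse[OF _ M NM] N by simp
    have "mat_adjoint N * (U * C) = 0\<^sub>m n n"
      using eq \<open>S = 0\<close> u N C by (intro frobenius_sq_eq_0) auto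
    hence "M * mat_adjoint N * (U * C) = 0\<^sub>m n n"
      using M N u C by (simp add: assoc_mult_mat[of _ n n _ n _ n])
    hence "mat_adjoint U * (U * C) = 0\<^sub>m n n"
      using u C by (simp add: MN)
    thus False
      using unitary_cancel(1)[OF U C] assms(3) by simp
  qed
  moreover have "0 \<le> S"
    using eq frobenius_sq_nonneg by metis
  ultimately have S: "0 < S"
    by simp
  obtain A where A: "A \<in> num_radius_sphere n C" "trace_form \<Delta> A = 1 / S"
    and min: "\<And>B. B \<in> num_radius_sphere n C \<Longrightarrow> 1 / S \<le> trace_form \<Delta> B"
    using trace_form_min_on_sphere[OF C M N NM S le U eq] unfolding MM by blast
  have "min_trace \<Delta> (num_radius_sphere n C) = 1 / S"
    unfolding min_trace_def using A min by (intro cInf_eq_minimum) (auto intro: image_eqI[of _ _ A])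
  moreover have "min_trace_attained \<Delta> (num_radius_sphere n C)"
    unfolding min_trace_attained_def using A min by (intro bexI[of _ A]) auto
  ultimately show ?thesis
    unfolding sum_eq by (simp add: inverse_eq_divide)
qed

end
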